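(* Let $(X,T)$ be a topological dynamical system and let $\mathbf{F}=\{\mathbf{f}_n\}_{n=1}^\infty$ be a block sub-additive potential on $X$. Then $$GP(T,\mathbf{F})=\sup_{\mathcal{U}\in\mathcal{C}_X^o}GP(T,\mathbf{F},\mathcal{U}),$$ and, for every $\mu\in M(X,T)$, $$GP_\mu(T,\mathbf{F})=\sup_{\mathcal{U}\in\mathcal{C}_X^o}GP_\mu(T,\mathbf{F},\mathcal{U}).$$
   Context: A topological dynamical system (TDS) $(X,T)$ is a compact metric space $X$ with metric $d$ together with a continuous surjective map $T:X\to X$. $C(Z)$ is the space of real-valued continuous functions on $Z$; $M(X,T)$ is the set of $T$-invariant Borel probability measures on $X$. A block sub-additive potential on $X$ is a sequence $\mathbf{F}=\{\mathbf{f}_n\}_{n=1}^\infty$ with $\mathbf{f}_n\in C(X^n)$ such that $\mathbf{f}_{n+m}(x_0,\ldots,x_{n+m-1})\le \mathbf{f}_n(x_0,\ldots,x_{n-1})+\mathbf{f}_m(x_n,\ldots,x_{n+m-1})$ for all $m,n\ge 1$ and all points. Covers: for a subset $K$ of a compact metric space $Z$, a cover of $K$ is a finite family of Borel subsets of $K$ whose union is $K$; $\mathcal{C}_K$ is the set of all covers of $K$, and $\mathcal{C}_K^o$ the set of those consisting of relatively open sets. For $\mathcal{V}\in\mathcal{C}_K$ and $\mathcal{W}\in\mathcal{C}_Z$, $\mathcal{V}\succeq\mathcal{W}$ means every element of $\mathcal{V}$ is contained in some element of $\mathcal{W}$. For $\mathcal{U}\in\mathcal{C}_X$, $\mathcal{U}^n=\{U_1\times\cdots\times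 U_n: U_i\in\mathcal{U}\}\in\mathcal{C}_{X^n}$. Average pseudo-orbits: for $\delta>0$ (and $n\ge2$), $X^n_\delta$ is the set of $(x_0,\ldots,x_{n-1})\in X^n$ with $\frac{1}{n-1}\sum_{i=0}^{n-2}d(Tx_i,x_{i+1})\le\delta$. For $\mu\in M(X,T)$ and a finite set $L\subset C(X)$, $X^n_{\delta,\mu,L}$ is the set of $(x_0,\ldots,x_{n-1})\in X^n_\delta$ with $\max_{g\in L}|\frac1n\sum_{i=0}^{n-1}g(x_i)-\int g\,d\mu|\le\delta$. Conventions: $\log0=-\infty$; empty sets contribute $0$ to sums of suprema; an empty sum is $0$. Local pressures: $GP(T,\mathbf{F},\mathcal{U})=\inf_{\delta>0}\limsup_{n\to\infty}\frac1n\log GP_{n,\delta}(T,\mathbf{F},\mathcal{U})$, where $GP_{n,\delta}(T,\mathbf{F},\mathcal{U})=\inf\{\sum_{V\in\mathcal{V}}\sup_{\mathbf{x}\in V}e^{\mathbf{f}_n(\mathbf{x})}:\mathcal{V}\in\mathcal{C}_{X^n_\delta},\ \mathcal{V}\succeq\mathcal{U}^n\}$. Also $GP_\mu(T,\mathbf{F},\mathcal{U})=\inf_L\inf_{\delta>0}\limsup_{n\to\infty}\frac1n\log GP_{n,\delta,\mu,L}(T,\mathbf{F},\mathcal{U})$, with $L$ ranging over finite subsets of $C(X)$, where $GP_{n,\delta,\mu,L}(T,\mathbf{F},\mathcal{U})=\inf\{\sum_{V\in\mathcal{V}}\sup_{\mathbf{x}\in V}e^{\mathbf{f}_n(\mathbf{x})}:\mathcal{V}\in\mathcal{C}_{X^n_{\delta,\mu,L}},\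 \mathcal{V}\succeq\mathcal{U}^n\}$, equal to $0$ if $X^n_{\delta,\mu,L}=\emptyset$. Global pressures: a subset $E\subset X^n$ is $(n,\epsilon)$-separated if for any distinct $(x_i)_{i=0}^{n-1},(y_i)_{i=0}^{n-1}\in E$ there is $0\le i\le n-1$ with $d(x_i,y_i)>\epsilon$. Put $GP_{n,\delta}(T,\mathbf{F},\epsilon)=\sup\{\sum_{\mathbf{x}\in E}e^{\mathbf{f}_n(\mathbf{x})}: E\subset X^n_\delta \text{ is } (n,\epsilon)\text{-separated}\}$, $GP(T,\mathbf{F},\epsilon)=\inf_{\delta>0}\limsup_{n\to\infty}\frac1n\log GP_{n,\delta}(T,\mathbf{F},\epsilon)$ and $GP(T,\mathbf{F})=\lim_{\epsilon\to0}GP(T,\mathbf{F},\epsilon)$. Similarly $GP_{n,\delta,\mu,L}(T,\mathbf{F},\epsilon)=\sup\{\sum_{\mathbf{x}\in E}e^{\mathbf{f}_n(\mathbf{x})}: E\subset X^n_{\delta,\mu,L}\text{ is }(n,\epsilon)\text{-separated}\}$, $GP_\mu(T,\mathbf{F},\epsilon)=\inf_{L}\inf_{\delta>0}\limsup_{n\to\infty}\frac1n\log GP_{n,\delta,\mu,L}(T,\mathbf{F},\epsilon)$ ($L$ over finite subsets of $C(X)$) and $GP_\mu(T,\mathbf{F})=\lim_{\epsilon\to0}GP_\mu(T,\mathbf{F},\epsilon)$. *)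

theory Defs
  imports "HOL-Probability.Probability"
begin

section \<open>Systems, measures and potentials\<close>

text \<open>The compact metric space is the whole type \<open>'a\<close>.\<close>

definition tds :: "('a::metric_space \<Rightarrow> 'a) \<Rightarrow> bool" where
  "tds T \<longleftrightarrow> compact (UNIV :: 'a set) \<and> continuous_on UNIV T \<and> surj T"

definition invariant_measures :: "('a::metric_space \<Rightarrow> 'a) \<Rightarrow> 'a measure set" where
  "invariant_measures T =
     {\<mu>. prob_space \<mu> \<and> sets \<mu> = sets borel \<and> distr \<mu> borel T = \<mu>}"

text \<open>
  \<open>X\<^sup>n\<close> consists of the functions on \<open>nat\<close> that are \<open>undefined\<close> outside \<open>{..<n}\<close>.
  The topology of \<open>nat \<Rightarrow> 'a\<close> is the product topology, and the topology (hence also the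
  Borel structure) that it induces on \<open>blocks n\<close> is the product topology of the \<open>n\<close> factors.
\<close>

definition blocks :: "nat \<Rightarrow> (nat \<Rightarrow> 'a) set" where
  "blocks n = PiE {..<n} (\<lambda>_. UNIV)"

definition block_subadditive :: "(nat \<Rightarrow> (nat \<Rightarrow> 'a::metric_space) \<Rightarrow> real) \<Rightarrow> bool" where
  "block_subadditive F \<longleftrightarrow>
     (\<forall>n\<ge>1. continuous_on (blocks n) (F n)) \<and>
     (\<forall>n\<ge>1. \<forall>m\<ge>1. \<forall>x\<in>blocks (n + m).
        F (n + m) x \<le> F n (\<lambda>i\<in>{..<n}. x i) + F m (\<lambda>i\<in>{..<m}. x (n + i)))"

section \<open>Covers\<close>

definition covers :: "'z::topological_space set \<Rightarrow> 'z set set set" where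
  "covers K = {\<V>. finite \<V> \<and> \<V> \<subseteq> sets (restrict_space borel K) \<and> \<Union>\<V> = K}"

definition open_covers :: "'z::topological_space set \<Rightarrow> 'z set set set" where
  "open_covers K = {\<V> \<in> covers K. \<forall>V\<in>\<V>. openin (top_of_set K) V}"

definition finer :: "'z set set \<Rightarrow> 'z set set \<Rightarrow> bool"  (infix "\<succeq>" 50) where
  "\<V> \<succeq> \<W> \<longleftrightarrow> (\<forall>V\<in>\<V>. \<exists>W\<in>\<W>. V \<subseteq> W)"

definition cover_power :: "'a set set \<Rightarrow> nat \<Rightarrow> (nat \<Rightarrow> 'a) set set" where
  "cover_power \<U> n = {PiE {..<n} U | U. \<forall>i<n. U i \<in> \<U>}"

section \<open>Average pseudo-orbits\<close>

definition avg_pseudo_orbits ::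
    "('a::metric_space \<Rightarrow> 'a) \<Rightarrow> nat \<Rightarrow> real \<Rightarrow> (nat \<Rightarrow> 'a) set" where
  "avg_pseudo_orbits T n \<delta> =
     {x \<in> blocks n. 1 / (real n - 1) * (\<Sum>i<n - 1. dist (T (x i)) (x (Suc i))) \<le> \<delta>}"

definition generic_pseudo_orbits ::
    "('a::metric_space \<Rightarrow> 'a) \<Rightarrow> 'a measure \<Rightarrow> ('a \<Rightarrow> real) set \<Rightarrow> nat \<Rightarrow> real \<Rightarrow> (nat \<Rightarrow> 'a) set"
  where
  "generic_pseudo_orbits T \<mu> L n \<delta> =
     {x \<in> avg_pseudo_orbits T n \<delta>.
        \<forall>g\<in>L. \<bar>1 / real n * (\<Sum>i<n. g (x i)) - (\<integral>y. g y \<partial>\<mu>)\<bar> \<le> \<delta>}"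

definition test_families :: "('a::metric_space \<Rightarrow> real) set set" where
  "test_families = {L. finite L \<and> (\<forall>g\<in>L. continuous_on UNIV g)}"

section \<open>Pressures\<close>

text \<open>\<open>log 0 = -\<infinity>\<close>.\<close>

definition log_ennreal :: "ennreal \<Rightarrow> ereal" where
  "log_ennreal a =
     (if a = 0 then -\<infinity> else if a = \<infinity> then \<infinity> else ereal (ln (enn2real a)))"

definition growth_rate :: "(nat \<Rightarrow> ennreal) \<Rightarrow> ereal" where
  "growth_rate a = limsup (\<lambda>n. ereal (1 / real n) * log_ennreal (a n))"

text \<open>
  The next two definitions are used with \<open>K = avg_pseudo_orbits T n \<delta>\<close>
  and \<open>K = generic_pseudo_orbits T \<mu> L n \<delta>\<close>.
  Suprema are taken in \<open>ennreal\<close>, so that the supremum over an empty set is \<open>0\<close>; in particular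
  \<open>cover_sum F n \<U> {} = 0\<close>.
\<close>

definition cover_sum ::
    "(nat \<Rightarrow> (nat \<Rightarrow> 'a::metric_space) \<Rightarrow> real) \<Rightarrow> nat \<Rightarrow> 'a set set \<Rightarrow> (nat \<Rightarrow> 'a) set \<Rightarrow> ennreal"
  where
  "cover_sum F n \<U> K =
     (INF \<V>\<in>{\<V> \<in> covers K. \<V> \<succeq> cover_power \<U> n}.
        \<Sum>V\<in>\<V>. SUP x\<in>V. ennreal (exp (F n x)))"

definition separated_blocks :: "nat \<Rightarrow> real \<Rightarrow> (nat \<Rightarrow> 'a::metric_space) set \<Rightarrow> bool" where
  "separated_blocks n \<epsilon> E \<longleftrightarrow>
     E \<subseteq> blocks n \<and> (\<forall>x\<in>E. \<forall>y\<in>E. x \<noteq> y \<longrightarrow> (\<exists>i<n. dist (x i) (y i) > \<epsilon>))"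

text \<open>
  When \<open>\<epsilon> > 0\<close> and \<open>'a\<close> is compact every \<open>(n, \<epsilon>)\<close>-separated set is finite, so the convention
  that \<^const>\<open>sum\<close> vanishes on infinite sets plays no role.
\<close>

definition separated_sum ::
    "(nat \<Rightarrow> (nat \<Rightarrow> 'a::metric_space) \<Rightarrow> real) \<Rightarrow> nat \<Rightarrow> real \<Rightarrow> (nat \<Rightarrow> 'a) set \<Rightarrow> ennreal"
  where
  "separated_sum F n \<epsilon> K =
     (SUP E\<in>{E. E \<subseteq> K \<and> separated_blocks n \<epsilon> E}. \<Sum>x\<in>E. ennreal (exp (F n x)))"

definition GP_cover ::
    "('a::metric_space \<Rightarrow> 'a) \<Rightarrow> (nat \<Rightarrow> (nat \<Rightarrow> 'a) \<Rightarrow> real) \<Rightarrow> 'a set set \<Rightarrow> ereal" where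
  "GP_cover T F \<U> =
     (INF \<delta>\<in>{0<..}. growth_rate (\<lambda>n. cover_sum F n \<U> (avg_pseudo_orbits T n \<delta>)))"

definition GP_measure_cover ::
    "('a::metric_space \<Rightarrow> 'a) \<Rightarrow> 'a measure \<Rightarrow> (nat \<Rightarrow> (nat \<Rightarrow> 'a) \<Rightarrow> real) \<Rightarrow> 'a set set \<Rightarrow> ereal"
  where
  "GP_measure_cover T \<mu> F \<U> =
     (INF L\<in>test_families. INF \<delta>\<in>{0<..}.
        growth_rate (\<lambda>n. cover_sum F n \<U> (generic_pseudo_orbits T \<mu> L n \<delta>)))"

definition GP_scale ::
    "('a::metric_space \<Rightarrow> 'a) \<Rightarrow> (nat \<Rightarrow> (nat \<Rightarrow> 'a) \<Rightarrow> real) \<Rightarrow> real \<Rightarrow> ereal" where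
  "GP_scale T F \<epsilon> =
     (INF \<delta>\<in>{0<..}. growth_rate (\<lambda>n. separated_sum F n \<epsilon> (avg_pseudo_orbits T n \<delta>)))"

definition GP_measure_scale ::
    "('a::metric_space \<Rightarrow> 'a) \<Rightarrow> 'a measure \<Rightarrow> (nat \<Rightarrow> (nat \<Rightarrow> 'a) \<Rightarrow> real) \<Rightarrow> real \<Rightarrow> ereal"
  where
  "GP_measure_scale T \<mu> F \<epsilon> =
     (INF L\<in>test_families. INF \<delta>\<in>{0<..}.
        growth_rate (\<lambda>n. separated_sum F n \<epsilon> (generic_pseudo_orbits T \<mu> L n \<delta>)))"

text \<open>
  \<^const>\<open>Lim\<close> is meaningful only if the limit exists; see \<open>GP_scale_tendsto\<close> and
  \<open>GP_measure_scale_tendsto\<close> below.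
\<close>

definition GP :: "('a::metric_space \<Rightarrow> 'a) \<Rightarrow> (nat \<Rightarrow> (nat \<Rightarrow> 'a) \<Rightarrow> real) \<Rightarrow> ereal" where
  "GP T F = Lim (at_right 0) (GP_scale T F)"

definition GP_measure ::
    "('a::metric_space \<Rightarrow> 'a) \<Rightarrow> 'a measure \<Rightarrow> (nat \<Rightarrow> (nat \<Rightarrow> 'a) \<Rightarrow> real) \<Rightarrow> ereal" where
  "GP_measure T \<mu> F = Lim (at_right 0) (GP_measure_scale T \<mu> F)"

section \<open>Existence of the limits as the scale tends to zero\<close>

lemma antimono_tendsto_SUP_at_right:
  fixes f :: "real \<Rightarrow> ereal"
  assumes anti: "\<And>x y. 0 < x \<Longrightarrow> x \<le> y \<Longrightarrow> f y \<le> f x"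
  shows "(f \<longlongrightarrow> (SUP x\<in>{0<..}. f x)) (at_right 0)"
proof (rule order_tendstoI)
  fix a assume "a < (SUP x\<in>{0<..}. f x)"
  then obtain y where y: "0 < y" "a < f y"
    by (auto simp: less_SUP_iff)
  show "\<forall>\<^sub>F x in at_right 0. a < f x"
    unfolding eventually_at_right_field
    using y anti by (meson less_le_trans less_imp_le)
next
  fix a assume a: "(SUP x\<in>{0<..}. f x) < a"
  show "\<forall>\<^sub>F x in at_right 0. f x < a"
    unfolding eventually_at_right_field
  proof (intro exI[of _ 1] conjI allI impI)
    fix y :: real assume "0 < y" "y < 1"
    then have "f y \<le> (SUP x\<in>{0<..}. f x)" by (intro SUP_upper) auto
    with a show "f y < a" by (rule le_less_trans[rotated])
  qed simp
qed

lemma log_ennreal_mono: "a \<le> b \<Longrightarrow> log_ennreal a \<le> log_ennreal b"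
  by (cases a; cases b)
     (auto simp: log_ennreal_def ennreal_eq_0_iff top_unique dest!: antisym_conv2)

lemma growth_rate_mono:
  assumes "\<And>n. a n \<le> b n"
  shows "growth_rate a \<le> growth_rate b"
  unfolding growth_rate_def
  by (intro Limsup_mono always_eventually allI ereal_mult_left_mono log_ennreal_mono assms) auto

lemma separated_sum_antimono:
  assumes "\<epsilon> \<le> \<epsilon>'"
  shows "separated_sum F n \<epsilon>' K \<le> separated_sum F n \<epsilon> K"
  unfolding separated_sum_def
  using assms
  by (intro SUP_subset_mono) (auto simp: separated_blocks_def, meson le_less_trans)

lemma GP_scale_tendsto: "(GP_scale T F \<longlongrightarrow> GP T F) (at_right 0)"
proof -
  have "(GP_scale T F \<longlongrightarrow> (SUP \<epsilon>\<in>{0<..}. GP_scale T F \<epsilon>)) (at_right 0)"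
    unfolding GP_scale_def
    by (intro antimono_tendsto_SUP_at_right INF_mono' growth_rate_mono separated_sum_antimono)
  then show ?thesis
    unfolding GP_def by (metis tendsto_Lim trivial_limit_at_right_real)
qed

lemma GP_measure_scale_tendsto:
  "(GP_measure_scale T \<mu> F \<longlongrightarrow> GP_measure T \<mu> F) (at_right 0)"
proof -
  have "(GP_measure_scale T \<mu> F \<longlongrightarrow> (SUP \<epsilon>\<in>{0<..}. GP_measure_scale T \<mu> F \<epsilon>)) (at_right 0)"
    unfolding GP_measure_scale_def
    by (intro antimono_tendsto_SUP_at_right INF_mono' growth_rate_mono separated_sum_antimono)
  then show ?thesis
    unfolding GP_measure_def by (metis tendsto_Lim trivial_limit_at_right_real)
qed

end

theory Submission
  imports Defs
begin

text \<open>
  If the members of \<open>\<U>\<close> have diameter at most \<open>\<epsilon>\<close>, a cover finer than \<open>\<U>\<^sup>n\<close> separates the points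
  of an \<open>(n, \<epsilon>)\<close>-separated set, so separated sums are bounded by cover sums.  Conversely, if
  \<open>\<epsilon>\<close> is a Lebesgue number of \<open>\<U>\<close>, pick greedily a point where the potential is maximal on the
  compact set of blocks that remain, and remove the open \<open>\<epsilon>\<close>-ball around it.  The chosen points are
  separated, and the removed pieces form a cover finer than \<open>\<U>\<^sup>n\<close> on each of which the supremum of
  the potential is attained at the chosen point.  Both comparisons hold for every \<open>n\<close> and every
  compact set of blocks.
\<close>

section \<open>Bowen balls and compactness of the sets of pseudo-orbits\<close>

text \<open>Coordinates from \<open>n\<close> on are left free, so that the ball is open in the
  whole space \<open>nat \<Rightarrow> 'a\<close> and not merely relative to
  \<open>blocks n\<close>.\<close>

definition bowen_ball :: "nat \<Rightarrow> real \<Rightarrow> (nat \<Rightarrow> 'a::metric_space) \<Rightarrow> (nat \<Rightarrow> 'a) set" where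
  "bowen_ball n \<epsilon> x = {y. \<forall>i<n. dist (x i) (y i) < \<epsilon>}"

lemma open_bowen_ball: "open (bowen_ball n \<epsilon> x)"
proof -
  have "bowen_ball n \<epsilon> x = (\<Inter>i\<in>{..<n}. {y. dist (x i) (y i) < \<epsilon>})"
    by (auto simp: bowen_ball_def)
  moreover have "open {y. dist (x i) (y i) < \<epsilon>}" for i
    by (intro open_Collect_less continuous_intros) auto
  ultimately show ?thesis
    by auto
qed

text \<open>Tychonoff's theorem applies once the blocks are written as a product over all of
  \<open>nat\<close>, with the singleton factor \<open>{undefined}\<close> at every index from
  \<open>n\<close> on.\<close>

lemma compact_blocks:
  assumes "compact (UNIV :: 'a::metric_space set)"
  shows "compact (blocks n :: (nat \<Rightarrow> 'a) set)"
proof -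
  have "(blocks n :: (nat \<Rightarrow> 'a) set) = PiE UNIV (\<lambda>i. if i < n then UNIV else {undefined})"
    by (rule set_eqI) (simp add: blocks_def PiE_iff extensional_def
        if_distrib[of "\<lambda>A. _ \<in> A"] cong: if_cong)
  also have "compactin (product_topology (\<lambda>_. euclidean) UNIV) \<dots>"
    using assms by (subst compactin_PiE) auto
  finally show ?thesis
    by (simp add: euclidean_product_topology)
qed

text \<open>A non-strict inequality between continuous functions of the coordinates cuts a closed
  piece out of the compact set \<open>blocks n\<close>. Compactness is what later lets the greedy
  selection find maxima and stop.\<close>

lemma compact_avg_pseudo_orbits:
  fixes T :: "'a::metric_space \<Rightarrow> 'a"
  assumes "compact (UNIV :: 'a set)" "continuous_on UNIV T"
  shows "compact (avg_pseudo_orbits T n \<delta>)"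
proof -
  have "continuous_on UNIV (\<lambda>x :: nat \<Rightarrow> 'a. T (x i))" for i
    by (rule continuous_on_compose2[OF assms(2) continuous_on_product_coordinates]) simp
  then have "closed {x. 1 / (real n - 1) * (\<Sum>i<n - 1. dist (T (x i)) (x (Suc i))) \<le> \<delta>}"
    by (intro closed_Collect_le continuous_intros) auto
  from compact_Int_closed[OF compact_blocks[OF assms(1), of n] this] show ?thesis
    by (simp add: avg_pseudo_orbits_def Int_def)
qed

lemma compact_generic_pseudo_orbits:
  fixes T :: "'a::metric_space \<Rightarrow> 'a"
  assumes "compact (UNIV :: 'a set)" "continuous_on UNIV T" "L \<in> test_families"
  shows "compact (generic_pseudo_orbits T \<mu> L n \<delta>)"
proof -
  have cont: "continuous_on UNIV (\<lambda>x :: nat \<Rightarrow> 'a. g (x i))" if "g \<in> L" for g i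
    using assms(3) that
    by (intro continuous_on_compose2[where g = g, OF _ continuous_on_product_coordinates])
      (auto simp: test_families_def)
  have "closed (\<Inter>g\<in>L. {x. \<bar>1 / real n * (\<Sum>i<n. g (x i)) - (\<integral>y. g y \<partial>\<mu>)\<bar> \<le> \<delta>})"
    by (intro closed_INT ballI closed_Collect_le continuous_intros cont)
  from compact_Int_closed[OF compact_avg_pseudo_orbits[OF assms(1,2), of n \<delta>] this] show ?thesis
    by (simp add: generic_pseudo_orbits_def Int_def)
qed

section \<open>Comparison of separated sums and cover sums for a fixed block length\<close>

lemma separated_sum_le_cover_sum:
  fixes F :: "nat \<Rightarrow> (nat \<Rightarrow> 'a::metric_space) \<Rightarrow> real"
  assumes small: "\<And>U x y. U \<in> \<U> \<Longrightarrow> x \<in> U \<Longrightarrow> y \<in> U \<Longrightarrow> dist x y \<le> \<epsilon>"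
  shows "separated_sum F n \<epsilon> K \<le> cover_sum F n \<U> K"
  unfolding separated_sum_def cover_sum_def
proof (intro SUP_least INF_greatest)
  fix E \<V>
  assume "E \<in> {E. E \<subseteq> K \<and> separated_blocks n \<epsilon> E}" "\<V> \<in> {\<V> \<in> covers K. \<V> \<succeq> cover_power \<U> n}"
  then have E: "E \<subseteq> K" "separated_blocks n \<epsilon> E"
    and \<V>: "finite \<V>" "\<Union>\<V> = K" "\<V> \<succeq> cover_power \<U> n"
    by (auto simp: covers_def)
  obtain v where v: "v x \<in> \<V>" "x \<in> v x" if "x \<in> E" for x
  proof -
    have "\<forall>x\<in>E. \<exists>V. V \<in> \<V> \<and> x \<in> V"
      using E(1) \<V>(2) by auto
    from bchoice[OF this] that show ?thesis
      by blast
  qed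
  \<comment> \<open>Two points in one cell lie in a common box of \<open>cover_power\<close>, so
    their coordinates are pairwise within \<epsilon>, against separation.\<close>
  have "inj_on v E"
  proof (rule inj_onI, rule ccontr)
    fix x y assume xy: "x \<in> E" "y \<in> E" "v x = v y" "x \<noteq> y"
    obtain U where "\<forall>i<n. U i \<in> \<U>" "v x \<subseteq> PiE {..<n} U"
      using \<V>(3) v(1)[OF xy(1)] by (fastforce simp: finer_def cover_power_def)
    then have "dist (x i) (y i) \<le> \<epsilon>" if "i < n" for i
      using that v(2)[OF xy(1)] v(2)[OF xy(2)] xy(3) by (intro small[of "U i"]) (auto simp: PiE_iff)
    then show False
      using E(2) xy by (force simp: separated_blocks_def)
  qed
  have "(\<Sum>x\<in>E. ennreal (exp (F n x))) \<le> (\<Sum>x\<in>E. SUP x\<in>v x. ennreal (exp (F n x)))"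
    using v(2) by (intro sum_mono SUP_upper)
  also have "\<dots> = (\<Sum>V\<in>v ` E. SUP x\<in>V. ennreal (exp (F n x)))"
    using \<open>inj_on v E\<close> by (simp add: sum.reindex)
  also have "\<dots> \<le> (\<Sum>V\<in>\<V>. SUP x\<in>V. ennreal (exp (F n x)))"
    using v(1) \<V>(1) by (intro sum_mono2) auto
  finally show "(\<Sum>x\<in>E. ennreal (exp (F n x))) \<le> (\<Sum>V\<in>\<V>. SUP x\<in>V. ennreal (exp (F n x)))" .
qed

text \<open>
  The finite family \<open>\<C>\<close> only serves to make the greedy selection terminate: every selected point
  exhausts the cells that contain it.
\<close>

lemma greedy_cover:
  fixes B :: "'z::topological_space \<Rightarrow> 'z set" and f :: "'z \<Rightarrow> real"
  assumes B: "\<And>x. open (B x)" "\<And>x y. y \<in> B x \<longleftrightarrow> x \<in> B y"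
    and "finite \<C>" "\<And>C x. C \<in> \<C> \<Longrightarrow> x \<in> C \<Longrightarrow> C \<subseteq> B x"
    and "compact K" "K \<subseteq> \<Union>\<C>" "continuous_on K f"
  shows "\<exists>E \<V>. finite E \<and> E \<subseteq> K \<and> (\<forall>x\<in>E. \<forall>y\<in>E. x \<noteq> y \<longrightarrow> y \<notin> B x) \<and>
    \<V> \<in> covers K \<and> (\<forall>V\<in>\<V>. \<exists>x\<in>K. V \<subseteq> B x) \<and>
    (\<Sum>V\<in>\<V>. SUP x\<in>V. ennreal (exp (f x))) \<le> (\<Sum>x\<in>E. ennreal (exp (f x)))"
  using assms(3-)
proof (induction \<C> arbitrary: K rule: finite_psubset_induct)
  case (psubset \<C>)
  show ?case
  proof (cases "K = {}")
    case True
    then show ?thesis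
      by (intro exI[of _ "{}"]) (auto simp: covers_def)
  next
    case False
    obtain x where x: "x \<in> K" "\<And>y. y \<in> K \<Longrightarrow> f y \<le> f x"
      using continuous_attains_sup[OF psubset.prems(2) False psubset.prems(4)] by auto
    obtain C where "C \<in> \<C>" "x \<in> C"
      using x(1) psubset.prems(3) by auto
    \<comment> \<open>Every cell containing \<open>x\<close> lies in \<open>B x\<close> and so
      misses \<open>?K\<close>; the other cells still cover \<open>?K\<close>. Dropping
      \<open>C\<close> makes the family strictly smaller.\<close>
    let ?K = "K - B x" and ?\<C> = "{C \<in> \<C>. x \<notin> C}"
    have "\<exists>E \<V>. finite E \<and> E \<subseteq> ?K \<and> (\<forall>x\<in>E. \<forall>y\<in>E. x \<noteq> y \<longrightarrow> y \<notin> B x) \<and>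
      \<V> \<in> covers ?K \<and> (\<forall>V\<in>\<V>. \<exists>x\<in>?K. V \<subseteq> B x) \<and>
      (\<Sum>V\<in>\<V>. SUP x\<in>V. ennreal (exp (f x))) \<le> (\<Sum>x\<in>E. ennreal (exp (f x)))"
    proof (rule psubset.IH)
      show "?\<C> \<subset> \<C>" using \<open>C \<in> \<C>\<close> \<open>x \<in> C\<close> by auto
      show "compact ?K" using psubset.prems(2) B(1) by (rule compact_diff)
      show "?K \<subseteq> \<Union>?\<C>"
      proof
        fix y assume y: "y \<in> ?K"
        then obtain D where "D \<in> \<C>" "y \<in> D"
          using psubset.prems(3) by auto
        with y psubset.prems(1)[of D x] show "y \<in> \<Union>?\<C>"
          by auto
      qed
      show "continuous_on ?K f" using psubset.prems(4) by (rule continuous_on_subset) auto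
    qed (use psubset.prems(1) in auto)
    then obtain E \<V> where E: "finite E" "E \<subseteq> ?K" "\<forall>x\<in>E. \<forall>y\<in>E. x \<noteq> y \<longrightarrow> y \<notin> B x"
      and \<V>: "\<V> \<in> covers ?K" "\<forall>V\<in>\<V>. \<exists>x\<in>?K. V \<subseteq> B x"
      and le: "(\<Sum>V\<in>\<V>. SUP x\<in>V. ennreal (exp (f x))) \<le> (\<Sum>x\<in>E. ennreal (exp (f x)))"
      by auto
    \<comment> \<open>Reflexivity comes from the cell \<open>C\<close>, which contains
      \<open>x\<close> and lies in \<open>B x\<close>. It keeps \<open>x\<close> out of
      \<open>E\<close>, so that \<open>x\<close> adds a new summand below.\<close>
    have "x \<in> B x"
      using \<open>C \<in> \<C>\<close> \<open>x \<in> C\<close> psubset.prems(1) by auto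
    \<comment> \<open>A Borel trace on \<open>?K\<close> is one on \<open>K\<close>: the open set
      \<open>B x\<close> is removed from the Borel set \<open>A\<close> instead of from
      \<open>K\<close>.\<close>
    have "V \<in> sets (restrict_space borel K)" if V: "V \<in> \<V>" for V
    proof -
      obtain A where A: "A \<in> sets borel" "V = ?K \<inter> A"
        using V \<V>(1) by (auto simp: covers_def sets_restrict_space)
      then have "V = K \<inter> (A - B x)" "A - B x \<in> sets borel"
        using B(1)[of x] by auto
      then show ?thesis
        by (auto simp: sets_restrict_space)
    qed
    moreover have "K \<inter> B x \<in> sets (restrict_space borel K)"
      using B(1)[of x] by (auto simp: sets_restrict_space)
    ultimately have cov: "insert (K \<inter> B x) \<V> \<in> covers K"
      using \<V>(1) by (auto simp: covers_def)
    have "(\<Sum>V\<in>insert (K \<inter> B x) \<V>. SUP x\<in>V. ennreal (exp (f x)))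
        \<le> (SUP x\<in>K \<inter> B x. ennreal (exp (f x))) + (\<Sum>V\<in>\<V>. SUP x\<in>V. ennreal (exp (f x)))"
      using \<V>(1) by (auto simp: covers_def sum.insert_if)
    also have "\<dots> \<le> ennreal (exp (f x)) + (\<Sum>x\<in>E. ennreal (exp (f x)))"
      using le x(2) by (intro add_mono SUP_least) (auto intro!: ennreal_leI)
    also have "\<dots> = (\<Sum>x\<in>insert x E. ennreal (exp (f x)))"
      using E(1,2) \<open>x \<in> B x\<close> by (subst sum.insert) auto
    finally have sum_le: "(\<Sum>V\<in>insert (K \<inter> B x) \<V>. SUP x\<in>V. ennreal (exp (f x)))
      \<le> (\<Sum>x\<in>insert x E. ennreal (exp (f x)))" .
    \<comment> \<open>\<open>E\<close> avoids \<open>B x\<close>; symmetry of \<open>B\<close> gives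
      the converse, that \<open>x\<close> avoids the sets \<open>B y\<close> with \<open>y\<close>
      in \<open>E\<close>.\<close>
    have sep: "\<forall>y\<in>insert x E. \<forall>z\<in>insert x E. y \<noteq> z \<longrightarrow> z \<notin> B y"
      using E(2,3) B(2) by blast
    show ?thesis
    proof (intro exI conjI)
      show "\<forall>V\<in>insert (K \<inter> B x) \<V>. \<exists>x\<in>K. V \<subseteq> B x"
        using \<V>(2) x(1) by auto
    qed (use E(1,2) x(1) sep cov sum_le in auto)
  qed
qed

text \<open>The greedy selection runs with Bowen balls of radius \<epsilon>, a Lebesgue number of
  \<U>. Selected points have distance at least \<epsilon> in some coordinate, whereas
  \<open>separated_blocks\<close> asks for a strict inequality; hence the smaller scale
  \<epsilon>'.\<close>

lemma cover_sum_le_separated_sum: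
  fixes F :: "nat \<Rightarrow> (nat \<Rightarrow> 'a::metric_space) \<Rightarrow> real"
  assumes "compact (UNIV :: 'a set)" "compact K" "K \<subseteq> blocks n" "continuous_on K (F n)"
    and \<epsilon>: "0 < \<epsilon>" "\<And>x. \<exists>U\<in>\<U>. ball x \<epsilon> \<subseteq> U" and "\<epsilon>' < \<epsilon>"
  shows "cover_sum F n \<U> K \<le> separated_sum F n \<epsilon>' K"
proof -
  \<comment> \<open>The cells are Bowen balls of half the radius: by the triangle inequality such a
    cell lies in the \<epsilon>-ball around any of its points.\<close>
  have "K \<subseteq> (\<Union>x\<in>K. bowen_ball n (\<epsilon> / 2) x)"
    using \<epsilon>(1) by (auto simp: bowen_ball_def)
  then obtain S where S: "finite S" "K \<subseteq> (\<Union>x\<in>S. bowen_ball n (\<epsilon> / 2) x)"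
    by (rule compactE_image[OF assms(2) open_bowen_ball]) blast
  have "\<exists>E \<V>. finite E \<and> E \<subseteq> K \<and> (\<forall>x\<in>E. \<forall>y\<in>E. x \<noteq> y \<longrightarrow> y \<notin> bowen_ball n \<epsilon> x) \<and>
    \<V> \<in> covers K \<and> (\<forall>V\<in>\<V>. \<exists>x\<in>K. V \<subseteq> bowen_ball n \<epsilon> x) \<and>
    (\<Sum>V\<in>\<V>. SUP x\<in>V. ennreal (exp (F n x))) \<le> (\<Sum>x\<in>E. ennreal (exp (F n x)))"
  proof (rule greedy_cover)
    show "finite (bowen_ball n (\<epsilon> / 2) ` S)" using S(1) by simp
    show "C \<subseteq> bowen_ball n \<epsilon> x" if "C \<in> bowen_ball n (\<epsilon> / 2) ` S" "x \<in> C" for C x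
      using that
      by (auto simp: bowen_ball_def simp del: less_divide_eq_numeral1 intro: dist_triangle_half_r)
  qed (use S assms open_bowen_ball in \<open>auto simp: bowen_ball_def dist_commute\<close>)
  then obtain E \<V> where E: "E \<subseteq> K" "\<forall>x\<in>E. \<forall>y\<in>E. x \<noteq> y \<longrightarrow> y \<notin> bowen_ball n \<epsilon> x"
    and \<V>: "\<V> \<in> covers K" "\<forall>V\<in>\<V>. \<exists>x\<in>K. V \<subseteq> bowen_ball n \<epsilon> x"
    and le: "(\<Sum>V\<in>\<V>. SUP x\<in>V. ennreal (exp (F n x))) \<le> (\<Sum>x\<in>E. ennreal (exp (F n x)))"
    by (elim exE conjE)
  have sep: "separated_blocks n \<epsilon>' E"
    unfolding separated_blocks_def
  proof (intro conjI ballI impI)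
    show "\<exists>i<n. \<epsilon>' < dist (x i) (y i)" if "x \<in> E" "y \<in> E" "x \<noteq> y" for x y
    proof -
      have "y \<notin> bowen_ball n \<epsilon> x"
        using E(2) that by blast
      then obtain i where "i < n" "\<epsilon> \<le> dist (x i) (y i)"
        by (auto simp: bowen_ball_def not_less)
      with \<open>\<epsilon>' < \<epsilon>\<close> show ?thesis
        by (intro exI[of _ i]) simp
    qed
  qed (use E(1) assms(3) in auto)
  obtain U where U: "\<And>x. U x \<in> \<U>" "\<And>x. ball x \<epsilon> \<subseteq> U x"
    using \<epsilon>(2) by metis
  have "\<V> \<succeq> cover_power \<U> n"
    unfolding finer_def
  proof
    fix V assume V: "V \<in> \<V>"
    then obtain x where "V \<subseteq> bowen_ball n \<epsilon> x"
      using \<V>(2) by blast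
    \<comment> \<open>Membership in the box also requires the value \<open>undefined\<close> from
      index \<open>n\<close> on, which a Bowen ball does not control.\<close>
    moreover have "V \<subseteq> blocks n"
      using V \<V>(1) assms(3) by (auto simp: covers_def)
    ultimately have "V \<subseteq> PiE {..<n} (\<lambda>i. U (x i))"
      using U(2) by (force simp: blocks_def bowen_ball_def PiE_iff subset_iff)
    moreover have "PiE {..<n} (\<lambda>i. U (x i)) \<in> cover_power \<U> n"
      using U(1) by (auto simp: cover_power_def)
    ultimately show "\<exists>W\<in>cover_power \<U> n. V \<subseteq> W" ..
  qed
  then have "cover_sum F n \<U> K \<le> (\<Sum>V\<in>\<V>. SUP x\<in>V. ennreal (exp (F n x)))"
    unfolding cover_sum_def using \<V>(1) by (intro INF_lower) simp
  also note le
  also have "(\<Sum>x\<in>E. ennreal (exp (F n x))) \<le> separated_sum F n \<epsilon>' K"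
    unfolding separated_sum_def using E(1) sep by (intro SUP_upper) simp
  finally show ?thesis .
qed

section \<open>Passage from fixed block length to the pressures\<close>

lemma open_covers_UNIV_iff:
  "\<U> \<in> open_covers UNIV \<longleftrightarrow> finite \<U> \<and> (\<forall>U\<in>\<U>. open U) \<and> \<Union>\<U> = UNIV"
  by (auto simp: open_covers_def covers_def sets_restrict_space)

text \<open>By compactness finitely many balls of radius \<epsilon>/2 suffice.\<close>

lemma ex_open_cover_small_diameter:
  assumes "compact (UNIV :: 'a set)" "0 < \<epsilon>"
  obtains \<U> :: "'a::metric_space set set" where "\<U> \<in> open_covers UNIV"
    "\<And>U x y. U \<in> \<U> \<Longrightarrow> x \<in> U \<Longrightarrow> y \<in> U \<Longrightarrow> dist x y \<le> \<epsilon>"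
proof -
  obtain S :: "'a set" where S: "finite S" "UNIV \<subseteq> (\<Union>x\<in>S. ball x (\<epsilon> / 2))"
    by (rule compactE_image[OF assms(1), of UNIV "\<lambda>x. ball x (\<epsilon> / 2)"]) (use assms(2) in auto)
  show ?thesis
  proof
    show "(\<lambda>x. ball x (\<epsilon> / 2)) ` S \<in> open_covers UNIV"
      using S by (auto simp: open_covers_UNIV_iff)
  qed (auto simp del: less_divide_eq_numeral1 intro: less_imp_le[OF dist_triangle_half_r])
qed

text \<open>The index \<open>i\<close> stands for \<open>\<delta>\<close> in the global case and for \<open>(L, \<delta>)\<close> in the case of a measure.\<close>

lemma SUP_scale_eq_SUP_open_covers:
  fixes F :: "nat \<Rightarrow> (nat \<Rightarrow> 'a::metric_space) \<Rightarrow> real" and K :: "'i \<Rightarrow> nat \<Rightarrow> (nat \<Rightarrow> 'a) set"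
  assumes compact: "compact (UNIV :: 'a set)" and F: "\<And>n. 1 \<le> n \<Longrightarrow> continuous_on (blocks n) (F n)"
    and K: "\<And>i n. i \<in> I \<Longrightarrow> compact (K i n)" "\<And>i n. i \<in> I \<Longrightarrow> K i n \<subseteq> blocks n"
  shows "(SUP \<epsilon>\<in>{0<..}. INF i\<in>I. growth_rate (\<lambda>n. separated_sum F n \<epsilon> (K i n)))
    = (SUP \<U>\<in>open_covers UNIV. INF i\<in>I. growth_rate (\<lambda>n. cover_sum F n \<U> (K i n)))"
\<comment> \<open>Each scale is matched with a cover of small diameter, and each cover with a scale
  below its Lebesgue number.\<close>
proof (rule antisym; rule SUP_mono)
  fix \<epsilon> :: real assume "\<epsilon> \<in> {0<..}"
  with compact obtain \<U> :: "'a set set" where \<U>: "\<U> \<in> open_covers UNIV"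
    "\<And>U x y. U \<in> \<U> \<Longrightarrow> x \<in> U \<Longrightarrow> y \<in> U \<Longrightarrow> dist x y \<le> \<epsilon>"
    by (auto elim: ex_open_cover_small_diameter)
  then show "\<exists>\<U>\<in>open_covers UNIV. (INF i\<in>I. growth_rate (\<lambda>n. separated_sum F n \<epsilon> (K i n)))
      \<le> (INF i\<in>I. growth_rate (\<lambda>n. cover_sum F n \<U> (K i n)))"
    by (intro bexI[OF _ \<U>(1)] INF_mono' growth_rate_mono separated_sum_le_cover_sum \<U>(2))
next
  fix \<U> :: "'a set set" assume "\<U> \<in> open_covers UNIV"
  then have "UNIV \<subseteq> \<Union>\<U>" "\<And>U. U \<in> \<U> \<Longrightarrow> open U"
    by (simp_all add: open_covers_UNIV_iff)
  then obtain \<epsilon> where \<epsilon>: "0 < \<epsilon>" "\<And>x. \<exists>U\<in>\<U>. ball x \<epsilon> \<subseteq> U"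
    using Heine_Borel_lemma[OF compact] by (metis UNIV_I)
  \<comment> \<open>\<open>growth_rate_mono\<close> compares all indices, including 0; there
    \<open>blocks 0\<close> is a single point and continuity is trivial.\<close>
  have F': "continuous_on (blocks n) (F n)" for n
  proof (cases "n = 0")
    case True
    then show ?thesis by (simp add: blocks_def)
  qed (simp add: F)
  have "cover_sum F n \<U> (K i n) \<le> separated_sum F n (\<epsilon> / 2) (K i n)" if "i \<in> I" for i n
    using compact K[OF that] continuous_on_subset[OF F' K(2)[OF that]] \<epsilon>
    by (rule cover_sum_le_separated_sum) (use \<epsilon>(1) in simp)
  then have "(INF i\<in>I. growth_rate (\<lambda>n. cover_sum F n \<U> (K i n)))
      \<le> (INF i\<in>I. growth_rate (\<lambda>n. separated_sum F n (\<epsilon> / 2) (K i n)))"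
    by (intro INF_superset_mono growth_rate_mono) auto
  then show "\<exists>\<epsilon>\<in>{0<..}. (INF i\<in>I. growth_rate (\<lambda>n. cover_sum F n \<U> (K i n)))
      \<le> (INF i\<in>I. growth_rate (\<lambda>n. separated_sum F n \<epsilon> (K i n)))"
    using \<epsilon>(1) by (intro bexI[of _ "\<epsilon> / 2"]) auto
qed

text \<open>Separated sums grow as the scale shrinks, so the limit at 0 is a supremum.\<close>

lemma GP_eq_SUP: "GP T F = (SUP \<epsilon>\<in>{0<..}. GP_scale T F \<epsilon>)"
  by (rule tendsto_unique[OF trivial_limit_at_right_real GP_scale_tendsto
      antimono_tendsto_SUP_at_right])
    (unfold GP_scale_def, intro INF_mono' growth_rate_mono separated_sum_antimono)

lemma GP_measure_eq_SUP: "GP_measure T \<mu> F = (SUP \<epsilon>\<in>{0<..}. GP_measure_scale T \<mu> F \<epsilon>)"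
  by (rule tendsto_unique[OF trivial_limit_at_right_real GP_measure_scale_tendsto
      antimono_tendsto_SUP_at_right])
    (unfold GP_measure_scale_def, intro INF_mono' growth_rate_mono separated_sum_antimono)

theorem theorem1p4:
  fixes T :: "'a::metric_space \<Rightarrow> 'a"
    and F :: "nat \<Rightarrow> (nat \<Rightarrow> 'a) \<Rightarrow> real"
  assumes "tds T"
    and "block_subadditive F"
  shows "GP T F = (SUP \<U>\<in>open_covers (UNIV :: 'a set). GP_cover T F \<U>)
    \<and> (\<forall>\<mu>\<in>invariant_measures T.
         GP_measure T \<mu> F = (SUP \<U>\<in>open_covers (UNIV :: 'a set). GP_measure_cover T \<mu> F \<U>))"
proof (intro conjI ballI)
  have T: "compact (UNIV :: 'a set)" "continuous_on UNIV T"
    using assms(1) by (auto simp: tds_def)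
  have F: "continuous_on (blocks n) (F n)" if "1 \<le> n" for n
    using assms(2) that by (auto simp: block_subadditive_def)
  show "GP T F = (SUP \<U>\<in>open_covers (UNIV :: 'a set). GP_cover T F \<U>)"
    unfolding GP_eq_SUP GP_scale_def GP_cover_def
    by (intro SUP_scale_eq_SUP_open_covers T F compact_avg_pseudo_orbits)
      (auto simp: avg_pseudo_orbits_def)
  show "GP_measure T \<mu> F = (SUP \<U>\<in>open_covers (UNIV :: 'a set). GP_measure_cover T \<mu> F \<U>)" for \<mu>
    \<comment> \<open>\<open>INF_pair\<close> merges the infima over \<open>L\<close> and \<delta>
      into one over pairs, which then serve as the index \<open>i\<close>.\<close>
    unfolding GP_measure_eq_SUP GP_measure_scale_def GP_measure_cover_def INF_pair
    by (intro SUP_scale_eq_SUP_open_covers T F compact_generic_pseudo_orbits)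
      (auto simp: generic_pseudo_orbits_def avg_pseudo_orbits_def)
qed

end
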